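(* Let $\nu>-1$ and let $0<x_{\nu,1}<x_{\nu,2}<\cdots$ be the positive zeros of the Bessel function $J_\nu$. Define $\zeta_{B,\nu}(2s)=\sum_{k\ge1}x_{\nu,k}^{-2s}$ and $\zeta_{B,\nu}(a,b)=\sum_{n_1>n_2\ge1}x_{\nu,n_1}^{-a}x_{\nu,n_2}^{-b}$. Then for every integer $s\ge0$, $$\zeta_{B,\nu}(2s+6)=\frac{2}{\nu+1}\sum_{\substack{a+b=s\\ a\ge-1,\ b\ge0}}\zeta_{B,\nu}(4+2a,\,2+2b).$$
   Context: The sum runs over integers $a\ge-1$, $b\ge0$ with $a+b=s$. $J_\nu(z)=\left(\frac z2\right)^{\nu}\sum_{k\ge0}\frac{(-1)^k}{\Gamma(\nu+k+1)k!}\left(\frac{z^2}{4}\right)^k$. *)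

theory Defs
  imports "HOL-Analysis.Analysis"
begin

text \<open>
  Real order and real argument suffice for the positive zeros. The prefactor is the intended
  power only for \<open>z > 0\<close>, because \<open>powr\<close> on the reals has junk values elsewhere.
\<close>
definition bessel_J :: "real \<Rightarrow> real \<Rightarrow> real" where
  "bessel_J \<nu> z =
     (z / 2) powr \<nu> * (\<Sum>k. (-1) ^ k / (Gamma (\<nu> + real k + 1) * fact k) * (z\<^sup>2 / 4) ^ k)"

text \<open>
  The sequences are indexed from \<open>1\<close>; the value at \<open>0\<close> is irrelevant throughout.
\<close>
definition positive_bessel_zeros :: "real \<Rightarrow> (nat \<Rightarrow> real) \<Rightarrow> bool" where
  "positive_bessel_zeros \<nu> x \<longleftrightarrow>
     strict_mono_on {1..} x \<and> x ` {1..} = {z. 0 < z \<and> bessel_J \<nu> z = 0}"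

definition bessel_zeta :: "(nat \<Rightarrow> real) \<Rightarrow> int \<Rightarrow> real" where
  "bessel_zeta x w = (\<Sum>\<^sub>\<infinity>k\<in>{1..}. x k powi (- w))"

definition bessel_double_zeta :: "(nat \<Rightarrow> real) \<Rightarrow> int \<Rightarrow> int \<Rightarrow> real" where
  "bessel_double_zeta x a b =
     (\<Sum>\<^sub>\<infinity>(n1, n2)\<in>{(n1, n2). n1 > n2 \<and> n2 \<ge> 1}. x n1 powi (- a) * x n2 powi (- b))"

end

theory Submission
  imports Defs "HOL-Computational_Algebra.Polynomial_FPS" "HOL-Real_Asymp.Real_Asymp"
begin

text \<open>
  Write \<open>S m = \<Sum> x_k^(-2 m)\<close>. The summands on the right-hand side are homogeneous of degree \<open>s + 3\<close> in
  the \<open>x_k^(-2)\<close>, and summing over \<open>a + b = s\<close> makes the total symmetric in the two zeros; hence it is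
  half of \<open>\<Sum> S i * S j - (s + 2) * S (s + 3)\<close> over \<open>i + j = s + 3\<close>, \<open>i, j \<ge> 1\<close>, and the claim is
  equivalent to Rayleigh's recursion \<open>(\<nu> + m) * S m = \<Sum> S i * S j\<close> over \<open>i + j = m\<close>.

  With \<open>a = \<nu> + 1\<close>, the Bessel function is up to elementary factors the series
  \<open>f t = \<Sum> (-t)^k / (k! (a)_k)\<close> at \<open>t = z\<^sup>2 / 4\<close>, a limit of rescaled Laguerre polynomials \<open>p\<close> with
  \<open>t p'' + (a - t / n) p' + p = 0\<close>. By Rolle's theorem \<open>p = \<Prod> (1 - u_k t)\<close> with positive
  \<open>u_k\<close>, and the logarithmic derivative of \<open>p\<close> satisfies a Riccati equation. Its power series
  expansion at \<open>0\<close> is the recursion for the power sums of the \<open>u_k\<close>, up to a term \<open>O (1 / n)\<close>, and its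
  values on the negative axis give \<open>u_k \<le> C / (k + 1)\<^sup>2\<close> uniformly in \<open>n\<close>. Dominated convergence along a
  subsequence with \<open>u_k \<longlongrightarrow> v_k\<close> then yields the recursion for the \<open>v_k\<close> and identifies the
  positive \<open>v_k\<close> with the reciprocals of the positive zeros of \<open>f\<close>, all of which are simple.
\<close>

section \<open>Zeros of Laguerre polynomials\<close>

text \<open>For \<open>a > 0\<close> this is the generalized Laguerre polynomial of index
  \<open>n\<close> and parameter \<open>a - 1\<close> at \<open>h * t\<close>, normalised to the
  value 1 at \<open>t = 0\<close>. The scale \<open>h\<close> will be \<open>1 / n\<close>, for
  which the limit is the Bessel series.\<close>

definition laguerre :: "nat \<Rightarrow> real \<Rightarrow> real \<Rightarrow> real poly" where
  "laguerre n a h = (\<Sum>k\<le>n. monom ((- h) ^ k * real (n choose k) / pochhammer a k) k)"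

lemma coeff_laguerre:
  "coeff (laguerre n a h) k = (- h) ^ k * real (n choose k) / pochhammer a k"
  by (auto simp: laguerre_def coeff_sum if_distrib[of "\<lambda>c. c / _"] coeff_monom sum.delta
      cong: if_cong)

lemma poly_laguerre:
  "poly (laguerre n a h) t = (\<Sum>k\<le>n. (- h) ^ k * real (n choose k) / pochhammer a k * t ^ k)"
  by (simp add: laguerre_def poly_sum poly_monom)

lemma degree_laguerre_le: "degree (laguerre n a h) \<le> n"
  by (rule degree_le) (simp add: coeff_laguerre)

lemma poly_laguerre_0: "poly (laguerre n a h) 0 = 1"
  by (simp add: poly_0_coeff_0 coeff_laguerre)

lemma of_nat_binomial_Suc:
  "real (Suc k) * real (n choose Suc k) = (real n - real k) * real (n choose k)"
proof (cases "k \<le> n")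
  case True
  have "Suc k * (n choose Suc k) = (n - k) * (n choose k)"
    by (metis binomial_absorb_comp binomial_absorption)
  from arg_cong[OF this, of real] show ?thesis
    using True by (simp only: of_nat_mult of_nat_diff)
next
  case False
  thus ?thesis by (simp add: binomial_eq_0)
qed

text \<open>Kummer's equation, rescaled by \<open>h\<close>. On coefficients it is the two-term
  recurrence \<open>(a + k) * (k + 1) * c (k + 1) = - h * (n - k) * c k\<close>, which comes from
  absorption for binomial coefficients.\<close>

lemma laguerre_ode:
  assumes "a > 0"
  shows "[:0, 1:] * pderiv (pderiv (laguerre n a h)) + [:a, - h:] * pderiv (laguerre n a h)
           + smult (real n * h) (laguerre n a h) = 0"
proof (rule poly_eqI)
  fix k
  define c where "c = coeff (laguerre n a h)"
  have pos: "pochhammer a k > 0" "a + k > 0"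
    using assms by (auto intro: pochhammer_pos)
  have "(a + k) * (real (Suc k) * c (Suc k)) = - h * (-h)^k * ((real (Suc k) * real (n choose Suc k)) / pochhammer a k)"
    using pos(2) nonzero_mult_divide_mult_cancel_left[of "a + real k"]
    unfolding c_def coeff_laguerre pochhammer_Suc by (simp add: mult_ac)
  also have "\<dots> = - h * (real n - real k) * c k"
    unfolding of_nat_binomial_Suc by (simp add: c_def coeff_laguerre)
  finally have *: "(a + k) * (real (Suc k) * c (Suc k)) = - h * (real n - real k) * c k" .
  show "coeff ([:0, 1:] * pderiv (pderiv (laguerre n a h)) + [:a, - h:] * pderiv (laguerre n a h)
           + smult (real n * h) (laguerre n a h)) k = coeff 0 k"
    using * by (cases k) (auto simp: coeff_pderiv coeff_pCons c_def[symmetric] algebra_simps)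
qed

text \<open>Times \<open>t powr (a - 1) * exp (- (h * t))\<close>, the right-hand side is the
  derivative of \<open>t powr a * exp (- (h * t))\<close> times the polynomial for \<open>n\<close>
  and \<open>a + 1\<close>. This Rodrigues-type relation lets Rolle's theorem raise the degree; on
  coefficients it is Pascal's rule.\<close>

lemma laguerre_Suc:
  assumes "a > 0"
  shows "smult a (laguerre (Suc n) a h) =
           [:a, - h:] * laguerre n (a + 1) h + [:0, 1:] * pderiv (laguerre n (a + 1) h)"
proof (rule poly_eqI)
  fix k
  show "coeff (smult a (laguerre (Suc n) a h)) k =
    coeff ([:a, - h:] * laguerre n (a + 1) h + [:0, 1:] * pderiv (laguerre n (a + 1) h)) k"
  proof (cases k)
    case 0
    thus ?thesis by (simp add: coeff_laguerre)
  next
    case (Suc j)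
    define P where "P = pochhammer (a + 1) j"
    have pos: "P > 0" "a + 1 + real j > 0"
      using assms by (auto simp: P_def intro: pochhammer_pos)
    have P: "pochhammer a (Suc j) = a * P" "pochhammer (a + 1) (Suc j) = P * (a + 1 + real j)"
      unfolding P_def by (rule pochhammer_rec pochhammer_Suc)+
    have "coeff ([:a, - h:] * laguerre n (a + 1) h + [:0, 1:] * pderiv (laguerre n (a + 1) h)) k =
      (a + 1 + real j) * coeff (laguerre n (a + 1) h) (Suc j) - h * coeff (laguerre n (a + 1) h) j"
      using Suc by (simp add: coeff_pderiv algebra_simps)
    also have "\<dots> = (- h) ^ Suc j * (real (n choose Suc j) + real (n choose j)) / P"
    proof -
      define x where "x = a + 1 + real j"
      have "x \<noteq> 0" "P \<noteq> 0" using pos by (auto simp: x_def)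
      thus ?thesis
        unfolding coeff_laguerre P P_def[symmetric] x_def[symmetric] by (simp add: field_simps)
    qed
    also have "\<dots> = coeff (smult a (laguerre (Suc n) a h)) k"
      using assms pos(1) unfolding Suc coeff_smult coeff_laguerre P by (simp add: field_simps)
    finally show ?thesis ..
  qed
qed

section \<open>Existence of \<open>n\<close> positive roots by Rolle's theorem\<close>

lemma Rolle_at_top:
  fixes f f' :: "real \<Rightarrow> real"
  assumes cont: "continuous_on {c..} f"
    and deriv: "\<And>t. t > c \<Longrightarrow> (f has_real_derivative f' t) (at t)"
    and "f c = 0" and lim: "(f \<longlongrightarrow> 0) at_top"
  shows "\<exists>t>c. f' t = 0"
proof -
  \<comment> \<open>Since \<open>g\<close> falls below \<open>g w\<close> at some
    \<open>T > w\<close>, its maximum over \<open>{c..T}\<close> is attained in the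
    interior.\<close>
  have pos: "\<exists>t>c. g' t = 0"
    if cont: "continuous_on {c..} g"
      and deriv: "\<And>t. t > c \<Longrightarrow> (g has_real_derivative g' t) (at t)"
      and g: "g c = 0" and lim: "(g \<longlongrightarrow> 0) at_top" and w: "w > c" "g w > 0"
    for g g' :: "real \<Rightarrow> real" and w
  proof -
    have "eventually (\<lambda>t. g t < g w) at_top"
      by (rule order_tendstoD(2)[OF lim w(2)])
    then obtain T where T: "T > w" "g T < g w"
      by (metis (no_types, lifting) eventually_at_top_dense gt_ex max_less_iff_conj)
    have "continuous_on {c..T} g"
      by (rule continuous_on_subset[OF cont]) auto
    then obtain m where m: "m \<in> {c..T}" "\<And>t. t \<in> {c..T} \<Longrightarrow> g t \<le> g m"
      using continuous_attains_sup[of "{c..T}" g] w T by fastforce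
    have "g w \<le> g m" using m w T by auto
    hence "m \<noteq> c" "m \<noteq> T" using g w T by auto
    hence in_i: "m \<in> {c<..<T}" using m by auto
    have "g' m = 0"
    proof (rule DERIV_local_max[OF deriv])
      show "m > c" using in_i by auto
      show "0 < min (m - c) (T - m)" using in_i by auto
      show "\<forall>y. \<bar>m - y\<bar> < min (m - c) (T - m) \<longrightarrow> g y \<le> g m"
      proof (intro allI impI)
        fix y assume "\<bar>m - y\<bar> < min (m - c) (T - m)"
        hence "y \<in> {c..T}" by (auto simp: abs_if split: if_splits)
        thus "g y \<le> g m" by (rule m(2))
      qed
    qed
    thus ?thesis using in_i by auto
  qed
  consider "\<exists>w>c. f w > 0" | "\<exists>w>c. f w < 0" | "\<And>t. t > c \<Longrightarrow> f t = 0"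
    by (meson linorder_neqE)
  thus ?thesis
  proof cases
    case 1
    thus ?thesis using pos[OF cont deriv \<open>f c = 0\<close> lim] by blast
  next
    case 2
    then obtain w where "w > c" "- f w > 0" by auto
    from pos[of "\<lambda>t. - f t" "\<lambda>t. - f' t", OF _ _ _ _ this] cont deriv \<open>f c = 0\<close> tendsto_minus[OF lim]
    show ?thesis by (auto intro!: continuous_intros derivative_intros)
  next
    case 3
    have "(f has_real_derivative 0) (at (c + 1))"
    proof (rule has_field_derivative_transform_within_open[of "\<lambda>_. 0"])
      show "open {c<..}" by simp
    qed (use 3 in auto)
    from DERIV_unique[OF this deriv] show ?thesis by (intro exI[of _ "c+1"]) auto
  qed
qed

lemma tendsto_poly_times_exp:
  fixes p :: "real poly"
  assumes "h > 0"
  shows "((\<lambda>t. t powr b * exp (- (h * t)) * poly p t) \<longlongrightarrow> 0) at_top"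
proof -
  have lim: "((\<lambda>t. t powr c * exp (- (h * t))) \<longlongrightarrow> 0) at_top" for c
    using assms by real_asymp
  have "((\<lambda>t. \<Sum>k\<le>degree p. coeff p k * (t powr (b + real k) * exp (- (h * t)))) \<longlongrightarrow>
     (\<Sum>k\<le>degree p. coeff p k * 0)) at_top"
    by (intro tendsto_intros lim)
  moreover have "eventually (\<lambda>t. (\<Sum>k\<le>degree p. coeff p k * (t powr (b + real k) * exp (- (h * t)))) =
     t powr b * exp (- (h * t)) * poly p t) at_top"
    using eventually_gt_at_top[of 0]
  proof eventually_elim
    case (elim t)
    thus ?case
      by (simp add: poly_altdef sum_distrib_left powr_add powr_realpow mult_ac)
  qed
  ultimately show ?thesis
    by (simp add: filterlim_cong)
qed

text \<open>Induction with \<open>a\<close> arbitrary, since index \<open>n + 1\<close> at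
  \<open>a\<close> is reached from index \<open>n\<close> at \<open>a + 1\<close>. The function
  \<open>H\<close> vanishes at 0, at the \<open>n\<close> known roots and at infinity, so its
  derivative has a zero in each of the \<open>n + 1\<close> gaps.\<close>

lemma laguerre_roots:
  assumes "a > 0" "h > 0"
  shows "\<exists>z. strict_mono_on {..<n} z \<and> (\<forall>i<n. 0 < z i \<and> poly (laguerre n a h) (z i) = 0)"
  using assms(1)
proof (induction n arbitrary: a)
  case 0
  show ?case by (auto simp: strict_mono_on_def)
next
  case (Suc n)
  let ?p = "laguerre n (a + 1) h"
  from Suc.IH[of "a + 1"] Suc.prems obtain z where
    z: "strict_mono_on {..<n} z" "\<And>i. i < n \<Longrightarrow> 0 < z i" "\<And>i. i < n \<Longrightarrow> poly ?p (z i) = 0"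
    by auto
  define y where "y i = (if i = 0 then 0 else z (i - 1))" for i
  define H where "H t = t powr a * exp (- (h * t)) * poly ?p t" for t
  define H' where "H' t = a * t powr (a - 1) * exp (- (h * t)) * poly (laguerre (Suc n) a h) t" for t
  have y0: "y i \<ge> 0" if "i \<le> n" for i
    using that z(2)[of "i - 1"] by (cases i) (auto simp: y_def less_imp_le)
  have y_less: "y i < y (Suc i)" if "i < n" for i
    using that z(2)[of i] strict_mono_onD[OF z(1), of "i - 1" i] by (cases i) (auto simp: y_def)
  have Hy: "H (y i) = 0" if "i \<le> n" for i
    using that z(3)[of "i - 1"] Suc.prems by (cases i) (auto simp: y_def H_def)
  have cont: "continuous_on {0..} H"
    unfolding H_def using Suc.prems by (intro continuous_intros continuous_on_powr') auto
  have deriv: "(H has_real_derivative H' t) (at t)" if "t > 0" for t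
  proof -
    have e: "a * poly (laguerre (Suc n) a h) t =
        (a - h * t) * poly ?p t + t * poly (pderiv ?p) t"
      using arg_cong[OF laguerre_Suc[OF Suc.prems, of n h], of "\<lambda>p. poly p t"] by (simp add: algebra_simps)
    have "(H has_real_derivative (a * t powr (a - 1) * exp (- (h * t)) - t powr a * (h * exp (- (h * t)))) * poly ?p t
       + t powr a * exp (- (h * t)) * poly (pderiv ?p) t) (at t)"
      unfolding H_def using that by (auto intro!: derivative_eq_intros poly_DERIV simp: algebra_simps)
    also have "t powr a = t * t powr (a - 1)"
      using that by (simp add: powr_diff)
    also have "(a * t powr (a - 1) * exp (- (h * t)) - t * t powr (a - 1) * (h * exp (- (h * t)))) * poly ?p t
       + t * t powr (a - 1) * exp (- (h * t)) * poly (pderiv ?p) t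
       = t powr (a - 1) * exp (- (h * t)) * ((a - h * t) * poly ?p t + t * poly (pderiv ?p) t)"
      by (simp add: algebra_simps)
    also have "\<dots> = H' t"
      unfolding e[symmetric] by (simp add: H'_def mult_ac)
    finally show ?thesis .
  qed
  \<comment> \<open>The gaps between consecutive \<open>y i\<close> are bounded; the one after
    \<open>y n\<close> is not, and there the exponential decay of \<open>H\<close> replaces the
    right endpoint.\<close>
  have "\<exists>t. y i < t \<and> (i < n \<longrightarrow> t < y (Suc i)) \<and> H' t = 0" if "i \<le> n" for i
  proof (cases "i < n")
    case True
    have "\<exists>t. y i < t \<and> t < y (Suc i) \<and> H' t = 0"
    proof -
      have "\<exists>t. y i < t \<and> t < y (Suc i) \<and> (H has_real_derivative 0) (at t)"
      proof (rule Rolle)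
        show "continuous_on {y i..y (Suc i)} H"
          by (rule continuous_on_subset[OF cont]) (use y0[OF that] in auto)
        show "H differentiable (at t)" if "y i < t" "t < y (Suc i)" for t
          using deriv[of t] that y0[OF \<open>i \<le> n\<close>] by (auto simp: real_differentiable_def)
      qed (use y_less Hy True in auto)
      then obtain t where t: "y i < t" "t < y (Suc i)" "(H has_real_derivative 0) (at t)" by blast
      have "H' t = 0"
        by (rule DERIV_unique[OF deriv t(3)]) (use t y0[OF that] in auto)
      with t show ?thesis by blast
    qed
    thus ?thesis by auto
  next
    case False
    have "\<exists>t>y i. H' t = 0"
    proof (rule Rolle_at_top)
      show "continuous_on {y i..} H"
        by (rule continuous_on_subset[OF cont]) (use y0[OF that] in auto)
      show "(H \<longlongrightarrow> 0) at_top"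
        unfolding H_def by (rule tendsto_poly_times_exp) fact
    qed (use y0[OF that] Hy[OF that] deriv in auto)
    with False show ?thesis by auto
  qed
  hence "\<forall>i. \<exists>t. i \<le> n \<longrightarrow> y i < t \<and> (i < n \<longrightarrow> t < y (Suc i)) \<and> H' t = 0"
    by blast
  from choice[OF this] obtain r where r: "\<And>i. i \<le> n \<Longrightarrow> y i < r i"
      "\<And>i. i < n \<Longrightarrow> r i < y (Suc i)" "\<And>i. i \<le> n \<Longrightarrow> H' (r i) = 0"
    by (metis less_imp_le)
  have rpos: "r i > 0" if "i \<le> n" for i
    using r(1) y0 that by force
  have ymono: "y i \<le> y j" if "i \<le> j" "j \<le> n" for i j
    using that(1,2)
  proof (induction rule: dec_induct)
    case (step m)
    thus ?case using y_less[of m] by auto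
  qed auto
  have "r i < r j" if "i < j" "j \<le> n" for i j
    using r(2)[of i] ymono[of "Suc i" j] r(1)[of j] that by auto
  moreover have "poly (laguerre (Suc n) a h) (r i) = 0" if "i \<le> n" for i
    using r(3)[OF that] rpos[OF that] Suc.prems by (auto simp: H'_def)
  ultimately show ?case
    using rpos by (intro exI[of _ r]) (auto simp: strict_mono_on_def less_Suc_eq_le)
qed

text \<open>Both sides have degree at most \<open>n\<close> and agree at \<open>n + 1\<close>
  points: the \<open>n\<close> roots, and 0, where both are 1.\<close>

lemma laguerre_factorization:
  assumes "a > 0" "h > 0"
  obtains u :: "nat \<Rightarrow> real" where "antimono_on {..<n} u" "\<And>i. i < n \<Longrightarrow> u i > 0"
    "laguerre n a h = (\<Prod>i<n. [:1, - u i:])"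
proof -
  obtain z where z: "strict_mono_on {..<n} z" "\<And>i. i < n \<Longrightarrow> 0 < z i"
     "\<And>i. i < n \<Longrightarrow> poly (laguerre n a h) (z i) = 0"
    using laguerre_roots[OF assms] by blast
  define u where "u i = 1 / z i" for i
  define q where "q = laguerre n a h - (\<Prod>i<n. [:1, - u i:])"
  have "degree (\<Prod>i<n. [:1, - u i:]) \<le> sum (degree \<circ> (\<lambda>i. [:1, - u i:])) {..<n}"
    by (rule degree_prod_sum_le) auto
  also have "\<dots> \<le> (\<Sum>i<n. 1)"
    by (intro sum_mono) auto
  finally have "degree q \<le> n"
    unfolding q_def by (intro degree_diff_le degree_laguerre_le) auto
  have roots: "insert 0 (z ` {..<n}) \<subseteq> {t. poly q t = 0}"
    using z(2,3) by (force simp: q_def poly_laguerre_0 poly_prod u_def)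
  have "card (insert 0 (z ` {..<n})) = Suc n"
    using z(2) by (subst card_insert_disjoint)
      (force simp: card_image[OF strict_mono_on_imp_inj_on[OF z(1)]])+
  hence "q = 0"
    using card_mono[OF poly_roots_finite roots] card_poly_roots_bound[of q] \<open>degree q \<le> n\<close> by linarith
  show thesis
  proof (rule that[of u])
    show "antimono_on {..<n} u"
    proof (intro monotone_onI)
      fix i j assume "i \<in> {..<n}" "j \<in> {..<n}" "i \<le> j"
      thus "u i \<ge> u j"
        using z(2)[of i] strict_mono_on_leD[OF z(1), of i j] by (auto simp: u_def intro!: divide_left_mono)
    qed
  qed (use z(2) \<open>q = 0\<close> in \<open>auto simp: q_def u_def\<close>)
qed

section \<open>The Riccati equation for the reciprocal roots\<close>

text \<open>Logarithmic differentiation: with \<open>Q = \<Sum> u i / (1 - u i * t)\<close> one has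
  \<open>P' = - P * Q\<close>, and \<open>Q'\<close> is the sum of the squares, so
  \<open>P'' = P * (Q\<^sup>2 - Q')\<close>.\<close>

lemma poly_pderiv_prod_linear:
  fixes u :: "nat \<Rightarrow> real"
  assumes "finite I" "\<And>i. i \<in> I \<Longrightarrow> 1 - u i * t \<noteq> 0"
  defines "P \<equiv> (\<Prod>i\<in>I. [:1, - u i:])"
  shows "poly (pderiv P) t = - poly P t * (\<Sum>i\<in>I. u i / (1 - u i * t))"
    and "poly (pderiv (pderiv P)) t =
      poly P t * ((\<Sum>i\<in>I. u i / (1 - u i * t))\<^sup>2 - (\<Sum>i\<in>I. (u i / (1 - u i * t))\<^sup>2))"
proof -
  have "poly (pderiv P) t = - poly P t * (\<Sum>i\<in>I. u i / (1 - u i * t)) \<and>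
    poly (pderiv (pderiv P)) t =
      poly P t * ((\<Sum>i\<in>I. u i / (1 - u i * t))\<^sup>2 - (\<Sum>i\<in>I. (u i / (1 - u i * t))\<^sup>2))"
    using assms(1,2) unfolding P_def
  proof (induction I rule: finite_induct)
    case empty
    show ?case by simp
  next
    case (insert j I)
    define R where "R = (\<Prod>i\<in>I. [:1, - u i:])"
    define q where "q = (\<Sum>i\<in>I. u i / (1 - u i * t))"
    define q2 where "q2 = (\<Sum>i\<in>I. (u i / (1 - u i * t))\<^sup>2)"
    define x where "x = 1 - u j * t"
    have x: "x \<noteq> 0" using insert.prems[of j] by (simp add: x_def)
    have IH: "poly (pderiv R) t = - poly R t * q"
      "poly (pderiv (pderiv R)) t = poly R t * (q\<^sup>2 - q2)"
      using insert.IH insert.prems unfolding R_def q_def q2_def by auto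
    have sums: "(\<Sum>i\<in>insert j I. u i / (1 - u i * t)) = u j / x + q"
      "(\<Sum>i\<in>insert j I. (u i / (1 - u i * t))\<^sup>2) = (u j / x)\<^sup>2 + q2"
      using insert.hyps by (simp_all add: q_def q2_def x_def)
    have prod: "(\<Prod>i\<in>insert j I. [:1, - u i:]) = [:1, - u j:] * R"
      using insert.hyps by (simp add: R_def)
    have d1: "pderiv ([:1, - u j:] * R) = [:1, - u j:] * pderiv R + [:- u j:] * R"
      unfolding pderiv_mult by (simp add: pderiv_pCons)
    have d2: "pderiv (pderiv ([:1, - u j:] * R)) =
        [:1, - u j:] * pderiv (pderiv R) + [:- u j:] * pderiv R + [:- u j:] * pderiv R"
      unfolding d1 pderiv_add pderiv_mult by (simp add: pderiv_pCons)
    have lin: "poly [:1, - u j:] t = x" by (simp add: x_def mult.commute)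
    show ?case
      unfolding sums prod d2 unfolding d1 poly_add poly_mult lin IH using x
      by (simp add: power2_eq_square) (simp add: algebra_simps)
  qed
  thus "poly (pderiv P) t = - poly P t * (\<Sum>i\<in>I. u i / (1 - u i * t))"
    and "poly (pderiv (pderiv P)) t =
      poly P t * ((\<Sum>i\<in>I. u i / (1 - u i * t))\<^sup>2 - (\<Sum>i\<in>I. (u i / (1 - u i * t))\<^sup>2))"
    by blast+
qed

text \<open>Newton's identities in generating form: expanding each
  \<open>u i / (1 - u i * X)\<close> as a geometric series turns the logarithmic derivative into the
  generating function of the power sums.\<close>

lemma fps_deriv_prod_linear:
  fixes u :: "nat \<Rightarrow> real"
  assumes "finite I"
  defines "P \<equiv> (\<Prod>i\<in>I. 1 - fps_const (u i) * fps_X)"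
  shows "fps_deriv P = - P * Abs_fps (\<lambda>m. \<Sum>i\<in>I. u i ^ Suc m)"
  using assms(1) unfolding P_def
proof (induction I rule: finite_induct)
  case empty
  have "Abs_fps (\<lambda>m. 0 :: real) = 0" by (simp add: fps_eq_iff)
  thus ?case by simp
next
  case (insert j I)
  define R where "R = (\<Prod>i\<in>I. 1 - fps_const (u i) * fps_X)"
  define G where "G = Abs_fps (\<lambda>m. u j ^ Suc m)"
  define S where "S = Abs_fps (\<lambda>m. \<Sum>i\<in>I. u i ^ Suc m)"
  have sum: "Abs_fps (\<lambda>m. \<Sum>i\<in>insert j I. u i ^ Suc m) = G + S"
    using insert.hyps by (simp add: G_def S_def fps_eq_iff)
  have prod: "(\<Prod>i\<in>insert j I. 1 - fps_const (u i) * fps_X) = (1 - fps_const (u j) * fps_X) * R"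
    using insert.hyps by (simp add: R_def)
  have geom: "(1 - fps_const (u j) * fps_X) * G = fps_const (u j)"
  proof (rule fps_ext)
    fix m show "fps_nth ((1 - fps_const (u j) * fps_X) * G) m = fps_nth (fps_const (u j)) m"
      by (cases m) (auto simp: G_def left_diff_distrib mult.assoc)
  qed
  have "fps_deriv ((1 - fps_const (u j) * fps_X) * R) =
      (1 - fps_const (u j) * fps_X) * (- R * S) - fps_const (u j) * R"
    using insert.IH unfolding R_def[symmetric] S_def[symmetric] fps_deriv_mult by (simp flip: fps_const_neg)
  also have "\<dots> = (1 - fps_const (u j) * fps_X) * (- R * S) - ((1 - fps_const (u j) * fps_X) * G) * R"
    by (simp only: geom)
  also have "\<dots> = - ((1 - fps_const (u j) * fps_X) * R) * (G + S)"
    by (simp add: algebra_simps)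
  finally show ?case unfolding sum prod .
qed

section \<open>Reciprocal roots of a polynomial solution: first power sum, decay and
  recursion\<close>

context
  fixes u :: "nat \<Rightarrow> real" and a h :: real and n :: nat
  assumes a: "a > 0" and h: "h \<ge> 0"
    and u_pos: "\<And>i. i < n \<Longrightarrow> u i > 0"
    and ode: "[:0, 1:] * pderiv (pderiv (\<Prod>i<n. [:1, - u i:])) + [:a, - h:] * pderiv (\<Prod>i<n. [:1, - u i:])
           + (\<Prod>i<n. [:1, - u i:]) = 0"
begin

text \<open>At \<open>t = 0\<close> the equation reduces to \<open>a * p' 0 + p 0 = 0\<close>, where
  \<open>p 0 = 1\<close> and \<open>p' 0\<close> is minus the sum.\<close>

lemma ode_reciprocal_roots_sum: "(\<Sum>i<n. u i) = 1 / a"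
proof -
  have "poly (\<Prod>i<n. [:1, - u i:]) 0 = 1"
    by (simp add: poly_prod)
  thus ?thesis
    using arg_cong[OF ode, of "\<lambda>p. poly p 0"] poly_pderiv_prod_linear(1)[of "{..<n}" u 0] a
    by (simp add: field_simps)
qed

text \<open>At \<open>t = -1 / u k\<close> the equation bounds the square of \<open>Q = \<Sum> u i / (1 - u i * t)\<close>, while the
  first \<open>k + 1\<close> terms of \<open>Q\<close> are at least \<open>u k / 2\<close>.\<close>
lemma ode_reciprocal_roots_bound:
  assumes mono: "antimono_on {..<n} u" and k: "k < n"
  shows "u k \<le> 4 * (1 + 1 / a) / (real k + 1)\<^sup>2"
proof -
  define r where "r = 1 / u k"
  define q where "q i = u i / (1 + u i * r)" for i
  define Q where "Q = (\<Sum>i<n. q i)"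
  define p where "p = poly (\<Prod>i<n. [:1, - u i:]) (- r)"
  have r: "r > 0" using u_pos[OF k] by (simp add: r_def)
  have den: "1 + u i * r > 1" if "i < n" for i
    using u_pos[OF that] r by simp
  have p: "p > 0"
    unfolding p_def poly_prod by (rule prod_pos) (use den in \<open>force simp: mult.commute\<close>)
  have nz: "1 - u i * - r \<noteq> 0" if "i \<in> {..<n}" for i
    using den[of i] that by simp
  have d: "poly (pderiv (\<Prod>i<n. [:1, - u i:])) (- r) = - p * Q"
    "poly (pderiv (pderiv (\<Prod>i<n. [:1, - u i:]))) (- r) = p * (Q\<^sup>2 - (\<Sum>i<n. (q i)\<^sup>2))"
    using poly_pderiv_prod_linear[of "{..<n}" u "- r", OF _ nz]
    by (simp_all add: p_def Q_def q_def)
  have "p * (- r * (Q\<^sup>2 - (\<Sum>i<n. (q i)\<^sup>2)) - (a + h * r) * Q + 1) = 0"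
    using arg_cong[OF ode, of "\<lambda>p. poly p (- r)"]
    by (simp add: d p_def[symmetric] algebra_simps)
  hence "- r * (Q\<^sup>2 - (\<Sum>i<n. (q i)\<^sup>2)) - (a + h * r) * Q + 1 = 0"
    using p by simp
  \<comment> \<open>The Riccati equation at \<open>- r\<close>. The squares on the right contribute
    at most \<open>Q \<le> 1 / a\<close>, because \<open>r * q i \<le> 1\<close>, and the last term
    is subtracted with a nonnegative value; so the bound on \<open>r * Q\<^sup>2\<close> involves
    neither \<open>h\<close> nor \<open>n\<close>.\<close>
  hence eq: "r * Q\<^sup>2 = 1 + r * (\<Sum>i<n. (q i)\<^sup>2) - (a + h * r) * Q"
    by (simp add: algebra_simps)
  have q_pos: "q i > 0" if "i < n" for i
    using u_pos[OF that] den[OF that] by (simp add: q_def)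
  have Q0: "Q \<ge> 0" unfolding Q_def by (intro sum_nonneg) (use q_pos in force)
  have "r * (\<Sum>i<n. (q i)\<^sup>2) \<le> Q"
    unfolding Q_def sum_distrib_left
  proof (rule sum_mono)
    fix i assume "i \<in> {..<n}"
    hence i: "i < n" by simp
    have "r * q i \<le> 1" using den[OF i] by (simp add: q_def field_simps)
    thus "r * (q i)\<^sup>2 \<le> q i"
      using mult_right_mono[of "r * q i" 1 "q i"] q_pos[OF i] by (simp add: power2_eq_square)
  qed
  moreover have "Q \<le> 1 / a"
    unfolding Q_def ode_reciprocal_roots_sum[symmetric]
  proof (rule sum_mono)
    fix i assume "i \<in> {..<n}"
    hence i: "i < n" by simp
    show "q i \<le> u i" 
      using den[OF i] u_pos[OF i] unfolding q_def by (simp add: divide_le_eq)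
  qed
  moreover have "(a + h * r) * Q \<ge> 0" using a h r Q0 by simp
  ultimately have "r * Q\<^sup>2 \<le> 1 + 1 / a" using eq by linarith
  hence Q_le: "Q\<^sup>2 \<le> (1 + 1 / a) * u k"
    using u_pos[OF k] by (simp add: r_def field_simps)
  \<comment> \<open>For \<open>i \<le> k\<close> monotonicity gives \<open>u i \<ge> u k\<close>,
    hence \<open>q i = u i * u k / (u k + u i) \<ge> u k / 2\<close>. Squaring the sum of these
    \<open>k + 1\<close> terms produces the quadratic decay.\<close>
  have "(real k + 1) * (u k / 2) = (\<Sum>i\<le>k. u k / 2)"
    by simp
  also have "\<dots> \<le> (\<Sum>i\<le>k. q i)"
  proof (rule sum_mono)
    fix i assume "i \<in> {..k}"
    hence i: "i < n" "u k \<le> u i"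
      using k monotone_onD[OF mono, of i k] by auto
    have "u k * (u k + u i) \<le> 2 * u k * u i"
      using i(2) u_pos[OF k] by (simp add: algebra_simps)
    hence "u k / 2 \<le> u i * u k / (u k + u i)"
      using u_pos[OF k] u_pos[OF i(1)] by (simp add: field_simps)
    also have "\<dots> = q i"
      using u_pos[OF k] u_pos[OF i(1)] by (simp add: q_def r_def field_simps)
    finally show "u k / 2 \<le> q i" .
  qed
  also have "\<dots> \<le> Q"
    unfolding Q_def by (rule sum_mono2) (use k q_pos in \<open>auto intro: less_imp_le\<close>)
  finally have "((real k + 1) * (u k / 2))\<^sup>2 \<le> Q\<^sup>2"
    by (rule power_mono) (use u_pos[OF k] in simp)
  moreover have "((real k + 1) * (u k / 2))\<^sup>2 = (real k + 1)\<^sup>2 * u k * u k / 4"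
    by (simp add: power2_eq_square)
  ultimately have "(real k + 1)\<^sup>2 * u k * u k \<le> 4 * ((1 + 1 / a) * u k)"
    using Q_le by linarith
  hence "(real k + 1)\<^sup>2 * u k * u k \<le> 4 * (1 + 1 / a) * u k"
    by (simp only: mult.assoc)
  hence "(real k + 1)\<^sup>2 * u k \<le> 4 * (1 + 1 / a)"
    using u_pos[OF k] by (simp only: mult_le_cancel_right_pos)
  thus ?thesis by (simp add: field_simps)
qed

text \<open>Cancelling \<open>P\<close> from the equation for formal power series leaves the Riccati
  equation \<open>X * (G\<^sup>2 - G') - (a - h * X) * G + 1 = 0\<close> for the generating function
  \<open>G\<close> of the power sums.\<close>

lemma ode_power_sum_recursion:
  "(a + real (Suc m)) * (\<Sum>i<n. u i ^ Suc (Suc m)) =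
     (\<Sum>k\<le>m. (\<Sum>i<n. u i ^ Suc k) * (\<Sum>i<n. u i ^ Suc (m - k))) + h * (\<Sum>i<n. u i ^ Suc m)"
proof -
  define P where "P = fps_of_poly (\<Prod>i<n. [:1, - u i:])"
  define G where "G = Abs_fps (\<lambda>m. \<Sum>i<n. u i ^ Suc m)"
  have P_eq: "P = (\<Prod>i<n. 1 - fps_const (u i) * fps_X)"
    unfolding P_def fps_of_poly_prod by (simp add: fps_of_poly_linear' flip: fps_const_neg)
  have d1: "fps_deriv P = - P * G"
    unfolding P_eq G_def by (rule fps_deriv_prod_linear) simp
  have d2: "fps_deriv (fps_deriv P) = P * (G * G - fps_deriv G)"
    unfolding d1 by (simp add: d1 algebra_simps)
  have lin: "fps_of_poly [:a, - h:] = fps_const a - fps_const h * fps_X"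
    by (simp add: fps_of_poly_pCons fps_of_poly_uminus fps_of_poly_const flip: fps_const_neg)
  have "fps_X * fps_deriv (fps_deriv P) + (fps_const a - fps_const h * fps_X) * fps_deriv P + P = 0"
    using arg_cong[OF ode, of fps_of_poly]
    unfolding fps_of_poly_add fps_of_poly_mult fps_of_poly_pderiv P_def[symmetric] lin by simp
  hence "P * (fps_X * (G * G - fps_deriv G) - (fps_const a - fps_const h * fps_X) * G + 1) = 0"
    unfolding d2 unfolding d1 by (simp add: algebra_simps)
  moreover have "fps_nth P 0 = 1"
    unfolding P_def by (simp add: poly_prod flip: poly_0_coeff_0)
  hence "P \<noteq> 0" by auto
  ultimately have "fps_X * (G * G - fps_deriv G) - (fps_const a - fps_const h * fps_X) * G + 1 = 0"
    by simp
  hence "fps_X * (G * G) - fps_X * fps_deriv G - fps_const a * G + fps_const h * (fps_X * G) + 1 = 0"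
    by (simp add: algebra_simps)
  \<comment> \<open>At this coefficient \<open>X * G'\<close> contributes \<open>m + 1\<close> times
    that of \<open>G\<close>, which joins the factor \<open>a\<close>, and the constant 1 drops
    out.\<close>
  from arg_cong[OF this, of "\<lambda>F. fps_nth F (Suc m)"]
  have "(a + real (Suc m)) * fps_nth G (Suc m) = fps_nth (G * G) m + h * fps_nth G m"
    by (simp add: algebra_simps)
  thus ?thesis
    by (simp add: fps_mult_nth G_def atLeast0AtMost)
qed

end

section \<open>The Bessel series\<close>

text \<open>Coefficients of the hypergeometric series 0F1 with parameter \<open>a\<close> at
  \<open>- t\<close>.\<close>

definition bessel_coeff :: "real \<Rightarrow> nat \<Rightarrow> real" where
  "bessel_coeff a k = (-1) ^ k / (fact k * pochhammer a k)"

definition bessel_series :: "real \<Rightarrow> real \<Rightarrow> real" where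
  "bessel_series a t = (\<Sum>k. bessel_coeff a k * t ^ k)"

definition bessel_series' :: "real \<Rightarrow> real \<Rightarrow> real" where
  "bessel_series' a t = (\<Sum>k. diffs (bessel_coeff a) k * t ^ k)"

definition bessel_series'' :: "real \<Rightarrow> real \<Rightarrow> real" where
  "bessel_series'' a t = (\<Sum>k. diffs (diffs (bessel_coeff a)) k * t ^ k)"

lemma bessel_series_0: "bessel_series a 0 = 1"
  unfolding bessel_series_def powser_zero by (simp add: bessel_coeff_def)

lemma summable_abs_bessel_series:
  fixes a t :: real
  assumes "a > 0"
  shows "summable (\<lambda>k. \<bar>t\<bar> ^ k / (fact k * pochhammer a k))"
proof -
  \<comment> \<open>Only the first factor \<open>a\<close> can be below 1. This uniform lower bound
    leaves a multiple of the exponential series as majorant.\<close>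
  have "pochhammer a k \<ge> min a 1" for k
  proof (induction k)
    case (Suc k)
    show ?case
    proof (cases "k = 0")
      case False
      have "min a 1 * 1 \<le> pochhammer a k * (a + real k)"
        using Suc assms False by (intro mult_mono) (auto simp: pochhammer_nonneg)
      thus ?thesis by (simp add: pochhammer_Suc)
    qed simp
  qed simp
  hence le: "\<bar>t\<bar> ^ k / (fact k * pochhammer a k) \<le> \<bar>t\<bar> ^ k / (fact k * min a 1)" for k
    using assms by (intro divide_left_mono mult_left_mono mult_pos_pos pochhammer_pos) auto
  have "summable (\<lambda>k. inverse (fact k) * \<bar>t\<bar> ^ k * (1 / min a 1))"
    by (intro summable_mult2 summable_exp)
  thus ?thesis
    by (rule summable_comparison_test')
      (use le assms in \<open>auto simp: divide_simps pochhammer_nonneg abs_mult\<close>)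
qed

lemma summable_bessel_series:
  assumes "a > 0"
  shows "summable (\<lambda>k. bessel_coeff a k * t ^ k)"
proof (rule summable_norm_cancel)
  have "norm (bessel_coeff a k * t ^ k) = \<bar>t\<bar> ^ k / (fact k * pochhammer a k)" for k
    using pochhammer_pos[OF assms, of k] by (simp add: bessel_coeff_def abs_mult power_abs)
  thus "summable (\<lambda>k. norm (bessel_coeff a k * t ^ k))"
    using summable_abs_bessel_series[OF assms] by simp
qed

lemma has_real_derivative_bessel_series:
  assumes "a > 0"
  shows "(bessel_series a has_real_derivative bessel_series' a t) (at t)"
  unfolding bessel_series_def[abs_def] bessel_series'_def
  by (rule termdiffs_strong_converges_everywhere) (rule summable_bessel_series[OF assms])

lemma has_real_derivative_bessel_series':
  assumes "a > 0"
  shows "(bessel_series' a has_real_derivative bessel_series'' a t) (at t)"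
  unfolding bessel_series'_def[abs_def] bessel_series''_def
  by (rule termdiffs_strong_converges_everywhere)
     (rule termdiff_converges_all, rule summable_bessel_series[OF assms])

lemma bessel_series_ode:
  assumes "a > 0"
  shows "t * bessel_series'' a t + a * bessel_series' a t + bessel_series a t = 0"
proof -
  let ?c = "bessel_coeff a"
  have sm: "summable (\<lambda>k. ?c k * x ^ k)" for x
    by (rule summable_bessel_series[OF assms])
  have sm': "summable (\<lambda>k. diffs ?c k * x ^ k)" for x
    by (rule termdiff_converges_all) (rule sm)
  have sm'': "summable (\<lambda>k. diffs (diffs ?c) k * x ^ k)" for x
    by (rule termdiff_converges_all) (rule sm')
  \<comment> \<open>Multiplying the second derivative by \<open>t\<close> shifts the index by one;
    as \<open>g 0 = 0\<close>, the shifted series has the same sum, and the three series can be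
    added termwise.\<close>
  define g where "g k = real k * diffs ?c k * t ^ k" for k
  have "(\<lambda>k. t * (diffs (diffs ?c) k * t ^ k)) sums (t * bessel_series'' a t)"
    unfolding bessel_series''_def by (intro sums_mult summable_sums sm'')
  moreover have "t * (diffs (diffs ?c) k * t ^ k) = g (Suc k)" for k
    by (simp add: g_def diffs_def algebra_simps)
  ultimately have "(\<lambda>k. g (Suc k)) sums (t * bessel_series'' a t)"
    by simp
  hence "g sums (t * bessel_series'' a t)"
    by (subst (asm) sums_Suc_iff) (simp add: g_def)
  hence "(\<lambda>k. g k + a * (diffs ?c k * t ^ k) + ?c k * t ^ k) sums
      (t * bessel_series'' a t + a * bessel_series' a t + bessel_series a t)"
    unfolding bessel_series'_def bessel_series_def
    by (intro sums_add sums_mult summable_sums sm sm')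
  moreover have "g k + a * (diffs ?c k * t ^ k) + ?c k * t ^ k = 0" for k
  proof -
    have "fact k * pochhammer a k > 0" "a + k > 0"
      using assms by (auto intro!: mult_pos_pos pochhammer_pos)
    hence "(a + k) * diffs ?c k = - ?c k"
      by (simp add: diffs_def bessel_coeff_def pochhammer_Suc divide_simps)
    moreover have "g k + a * (diffs ?c k * t ^ k) + ?c k * t ^ k = ((a + k) * diffs ?c k + ?c k) * t ^ k"
      by (simp add: g_def algebra_simps)
    ultimately show ?thesis by simp
  qed
  ultimately show ?thesis
    using sums_unique2[OF _ sums_zero] by simp
qed

text \<open>With \<open>E = f\<^sup>2 + t * f'\<^sup>2\<close> the equation gives \<open>E' = (1 - 2 * a) * f'\<^sup>2\<close>, hence
  \<open>E * t powr \<bar>2 * a - 1\<bar>\<close> is nondecreasing; so \<open>E\<close> cannot vanish at a positive point.\<close>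
lemma bessel_series_no_double_zero:
  assumes "a > 0" "y > 0" "bessel_series a y = 0"
  shows "bessel_series' a y \<noteq> 0"
proof
  assume d: "bessel_series' a y = 0"
  \<comment> \<open>Chosen so that both \<open>c \<ge> 0\<close> and
    \<open>c + (1 - 2 * a) \<ge> 0\<close>, the two signs on which monotonicity depends.\<close>
  define c where "c = \<bar>2 * a - 1\<bar>"
  let ?f = "bessel_series a" and ?f' = "bessel_series' a" and ?f'' = "bessel_series'' a"
  define E where "E t = (?f t)\<^sup>2 + t * (?f' t)\<^sup>2" for t
  have zero: "?f t = 0" if t: "0 < t" "t \<le> y" for t
  proof -
    have "E t * t powr c \<le> E y * y powr c"
    proof (rule DERIV_nonneg_imp_nondecreasing[OF t(2)])
      fix x assume "t \<le> x" "x \<le> y"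
      hence x: "x > 0" using t by simp
      have ode: "x * ?f'' x = - a * ?f' x - ?f x"
        using bessel_series_ode[OF assms(1), of x] by simp
      have "(E has_real_derivative (2 * ?f x * ?f' x + (?f' x)\<^sup>2 + 2 * ?f' x * (x * ?f'' x))) (at x)"
        unfolding E_def
        by (auto intro!: derivative_eq_intros has_real_derivative_bessel_series[OF assms(1)]
            has_real_derivative_bessel_series'[OF assms(1)] simp: power2_eq_square algebra_simps)
      hence "(E has_real_derivative (1 - 2 * a) * (?f' x)\<^sup>2) (at x)"
        unfolding ode by (simp add: power2_eq_square algebra_simps)
      hence "((\<lambda>t. E t * t powr c) has_real_derivative
          ((1 - 2 * a) * (?f' x)\<^sup>2 * x powr c + E x * (c * x powr (c - 1)))) (at x)"
        using x by (auto intro!: derivative_eq_intros)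
      also have "x powr c = x * x powr (c - 1)"
        using x by (simp add: powr_diff)
      finally have "((\<lambda>t. E t * t powr c) has_real_derivative
          x powr (c - 1) * ((c + (1 - 2 * a)) * (x * (?f' x)\<^sup>2) + c * (?f x)\<^sup>2)) (at x)"
        by (simp add: E_def algebra_simps)
      moreover have "c \<ge> 0" "c + (1 - 2 * a) \<ge> 0" by (auto simp: c_def)
      hence "x powr (c - 1) * ((c + (1 - 2 * a)) * (x * (?f' x)\<^sup>2) + c * (?f x)\<^sup>2) \<ge> 0"
        using x by (intro mult_nonneg_nonneg add_nonneg_nonneg[OF mult_nonneg_nonneg]) auto
      ultimately show "\<exists>z. ((\<lambda>t. E t * t powr c) has_real_derivative z) (at x) \<and> 0 \<le> z"
        by blast
    qed
    also have "E y = 0" by (simp add: E_def assms(3) d)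
    finally have "E t \<le> 0" using t by (simp add: mult_le_0_iff)
    moreover have "t * (?f' t)\<^sup>2 \<ge> 0" using t by simp
    ultimately have "(?f t)\<^sup>2 \<le> 0" unfolding E_def by linarith
    thus ?thesis by simp
  qed
  \<comment> \<open>Vanishing on all of \<open>(0, y]\<close> contradicts continuity at 0, where the
    series equals 1.\<close>
  have "isCont ?f 0"
    by (rule DERIV_isCont[OF has_real_derivative_bessel_series[OF assms(1)]])
  hence "(?f \<longlongrightarrow> ?f 0) (at_right 0)"
    by (simp add: isCont_def filterlim_at_split)
  moreover have "eventually (\<lambda>t. ?f t = 0) (at_right 0)"
    using eventually_at_right_less[of 0] eventually_at_right_real[OF assms(2)]
    by eventually_elim (use zero in auto)
  hence "(?f \<longlongrightarrow> 0) (at_right 0)"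
    by (rule tendsto_eventually)
  ultimately have "?f 0 = 0"
    using tendsto_unique trivial_limit_at_right_real by blast
  thus False by (simp add: bessel_series_0)
qed

section \<open>The Bessel series as a limit of Laguerre polynomials\<close>

lemma binomial_over_power_tendsto:
  "(\<lambda>n. real (n choose k) / real n ^ k) \<longlonglongrightarrow> 1 / fact k"
proof (induction k)
  case (Suc k)
  have "(\<lambda>n. (real n - real k) / real n) \<longlonglongrightarrow> 1"
    by real_asymp
  hence "(\<lambda>n. real (n choose k) / real n ^ k * ((real n - real k) / real n) / real (Suc k))
      \<longlonglongrightarrow> 1 / fact k * 1 / real (Suc k)"
    by (intro tendsto_intros Suc.IH) auto
  moreover have "real (n choose k) / real n ^ k * ((real n - real k) / real n) / real (Suc k)
      = real (n choose Suc k) / real n ^ Suc k" for n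
  proof -
    have "real (n choose k) / real n ^ k * ((real n - real k) / real n) / real (Suc k)
      = (real n - real k) * real (n choose k) / real (Suc k) / real n ^ Suc k"
      by (simp add: mult_ac)
    also have "\<dots> = real (n choose Suc k) / real n ^ Suc k"
      unfolding of_nat_binomial_Suc[symmetric] by (simp del: of_nat_Suc)
    finally show ?thesis .
  qed
  ultimately show ?case by (simp add: mult_ac)
qed simp

text \<open>Tannery's theorem: each coefficient converges, and
  \<open>(n choose k) / n ^ k \<le> 1 / k!\<close> supplies a summable majorant independent of
  \<open>n\<close>.\<close>

lemma laguerre_tendsto_bessel_series:
  assumes "a > 0"
  shows "(\<lambda>n. poly (laguerre n a (1 / real n)) t) \<longlonglongrightarrow> bessel_series a t"
proof -
  define f where "f k n = (- (1 / real n)) ^ k * real (n choose k) / pochhammer a k * t ^ k" for k n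
  have f_eq: "f k n = (- 1) ^ k * (real (n choose k) / real n ^ k) / pochhammer a k * t ^ k" for k n
    by (simp add: f_def power_minus[of "1 / real n"] power_divide)
  have "(\<lambda>n. \<Sum>k. f k n) \<longlonglongrightarrow> (\<Sum>k. bessel_coeff a k * t ^ k)"
  proof (intro tannerys_theorem[THEN conjunct2, THEN conjunct2])
    fix k
    have "(\<lambda>n. f k n) \<longlonglongrightarrow> (- 1) ^ k * (1 / fact k) / pochhammer a k * t ^ k"
      unfolding f_eq by (intro tendsto_intros binomial_over_power_tendsto)
        (use pochhammer_pos[OF assms, of k] in auto)
    thus "(\<lambda>n. f k n) \<longlonglongrightarrow> bessel_coeff a k * t ^ k"
      by (simp add: bessel_coeff_def)
  next
    show "summable (\<lambda>k. \<bar>t\<bar> ^ k / (fact k * pochhammer a k))"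
      by (rule summable_abs_bessel_series[OF assms])
    have "norm (f k n) \<le> \<bar>t\<bar> ^ k / (fact k * pochhammer a k)" for k n
    proof -
      have pos: "pochhammer a k > 0" by (rule pochhammer_pos[OF assms])
      have "real (n choose k) / real n ^ k \<le> 1 / fact k"
      proof (cases "n = 0")
        case False
        have "(n choose k) * fact k \<le> n ^ k"
          by (rule binomial_fact_pow)
        hence "real (n choose k) * fact k \<le> real n ^ k"
          by (metis of_nat_fact of_nat_le_iff of_nat_mult of_nat_power)
        thus ?thesis using False by (simp add: field_simps)
      qed (cases k; simp)
      hence "real (n choose k) / real n ^ k / pochhammer a k * \<bar>t\<bar> ^ k \<le> 1 / fact k / pochhammer a k * \<bar>t\<bar> ^ k"
        using pos by (intro mult_right_mono divide_right_mono) auto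
      thus ?thesis
        using pos by (simp add: f_eq abs_mult power_abs)
    qed
    thus "eventually (\<lambda>(k, n). norm (f k n) \<le> \<bar>t\<bar> ^ k / (fact k * pochhammer a k))
            (at_top \<times>\<^sub>F sequentially)"
      by (intro always_eventually) auto
  qed auto
  moreover have "(\<Sum>k. f k n) = poly (laguerre n a (1 / real n)) t" for n
    unfolding poly_laguerre f_def by (rule suminf_finite) (auto simp: not_le)
  ultimately show ?thesis by (simp add: bessel_series_def)
qed

section \<open>Passage to the limit\<close>

lemma pointwise_convergent_subsequence:
  fixes f :: "nat \<Rightarrow> nat \<Rightarrow> real"
  assumes "\<And>n k. f n k \<in> {0..M k}"
  shows "\<exists>r v. strict_mono r \<and> (\<forall>k. (\<lambda>j. f (r j) k) \<longlonglongrightarrow> v k)"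
proof -
  \<comment> \<open>Tychonoff's theorem makes this countable product of intervals compact, hence
    sequentially compact, and convergence in the product topology is coordinatewise.\<close>
  define K where "K = PiE UNIV (\<lambda>k. {0..M k})"
  have "compactin (product_topology (\<lambda>_. euclidean) UNIV) K"
    unfolding K_def compactin_PiE by auto
  hence "seq_compact K"
    by (simp add: euclidean_product_topology compact_imp_seq_compact)
  moreover have "\<forall>n. f n \<in> K" using assms by (auto simp: K_def)
  ultimately obtain v r where r: "strict_mono r" "(f \<circ> r) \<longlonglongrightarrow> v"
    by (metis seq_compactE)
  have "(\<lambda>j. f (r j) k) \<longlonglongrightarrow> v k" for k
  proof -
    have "continuous_on UNIV (\<lambda>g :: nat \<Rightarrow> real. g k)"
      by (rule continuous_on_product_coordinates)
    hence "isCont (\<lambda>g :: nat \<Rightarrow> real. g k) v"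
      using continuous_on_eq_continuous_at open_UNIV by blast
    from isCont_tendsto_compose[OF this r(2)] show ?thesis by simp
  qed
  with r(1) show ?thesis by blast
qed

text \<open>Any chosen set of factors can be kept while the others are bounded by an exponential. In
  the limit one kept factor shows that a zero is present, and two equal ones would force a double
  zero.\<close>

lemma prod_linear_upper_bound:
  fixes w :: "nat \<Rightarrow> real"
  assumes "\<And>k. w k \<ge> 0" "(\<Sum>k<n. w k) \<le> C" "I \<subseteq> {..<n}"
  shows "\<bar>\<Prod>k<n. 1 - w k * t\<bar> \<le> (\<Prod>k\<in>I. \<bar>1 - w k * t\<bar>) * exp (C * \<bar>t\<bar>)"
proof -
  have "\<bar>\<Prod>k<n. 1 - w k * t\<bar> = (\<Prod>k\<in>I. \<bar>1 - w k * t\<bar>) * (\<Prod>k\<in>{..<n}-I. \<bar>1 - w k * t\<bar>)"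
    by (simp add: abs_prod abs_mult prod.subset_diff[OF assms(3)])
  also have "(\<Prod>k\<in>{..<n}-I. \<bar>1 - w k * t\<bar>) \<le> (\<Prod>k\<in>{..<n}-I. 1 + w k * \<bar>t\<bar>)"
  proof (intro prod_mono conjI)
    fix k
    show "\<bar>1 - w k * t\<bar> \<le> 1 + w k * \<bar>t\<bar>"
      using abs_triangle_ineq4[of 1 "w k * t"] assms(1)[of k] by (simp add: abs_mult)
  qed auto
  also have "\<dots> \<le> exp (\<Sum>k\<in>{..<n}-I. w k * \<bar>t\<bar>)"
    by (rule prod_le_exp_sum) (use assms(1) in simp)
  also have "(\<Sum>k\<in>{..<n}-I. w k * \<bar>t\<bar>) \<le> (\<Sum>k<n. w k * \<bar>t\<bar>)"
    by (rule sum_mono2) (use assms(1) in auto)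
  also have "\<dots> \<le> C * \<bar>t\<bar>"
    unfolding sum_distrib_right[symmetric] using assms(2) by (rule mult_right_mono) simp
  finally show ?thesis
    by (simp add: mult_left_mono prod_nonneg)
qed

text \<open>Weierstrass's product inequality keeps the tail of the product above
  \<open>1 / 2\<close>, so that a zero of the limit can only come from the first \<open>K\<close>
  factors.\<close>

lemma prod_linear_lower_bound:
  fixes w :: "nat \<Rightarrow> real"
  assumes "\<And>k. w k \<ge> 0" "t \<ge> 0" "K \<le> n" "(\<Sum>k\<in>{K..<n}. w k * t) \<le> 1 / 2"
  shows "(\<Prod>k<K. \<bar>1 - w k * t\<bar>) / 2 \<le> \<bar>\<Prod>k<n. 1 - w k * t\<bar>"
proof -
  have nn: "w k * t \<ge> 0" for k using assms(1,2) by simp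
  have "w k * t \<le> 1" if "k \<in> {K..<n}" for k
    using member_le_sum[of k "{K..<n}" "\<lambda>k. w k * t"] that nn assms(4) by force
  hence "1 - (\<Sum>k\<in>{K..<n}. w k * t) \<le> (\<Prod>k\<in>{K..<n}. 1 - w k * t)"
    using nn by (intro Weierstrass_prod_ineq) auto
  hence ge: "1 / 2 \<le> (\<Prod>k\<in>{K..<n}. 1 - w k * t)"
    using assms(4) by linarith
  have "(\<Prod>k<n. 1 - w k * t) = (\<Prod>k<K. 1 - w k * t) * (\<Prod>k\<in>{K..<n}. 1 - w k * t)"
    using assms(3) by (subst prod.union_disjoint[symmetric]) (auto simp: ivl_disj_un)
  hence "\<bar>\<Prod>k<n. 1 - w k * t\<bar> = (\<Prod>k<K. \<bar>1 - w k * t\<bar>) * \<bar>\<Prod>k\<in>{K..<n}. 1 - w k * t\<bar>"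
    by (simp add: abs_mult abs_prod)
  also have "\<dots> \<ge> (\<Prod>k<K. \<bar>1 - w k * t\<bar>) * (1 / 2)"
    using ge by (intro mult_left_mono) (auto simp: prod_nonneg)
  finally show ?thesis by simp
qed

text \<open>The bound on the \<open>k\<close>-th reciprocal root, free of \<open>n\<close>; it is
  the majorant for all later passages to the limit.\<close>

definition root_bound :: "real \<Rightarrow> nat \<Rightarrow> real" where
  "root_bound a k = 4 * (1 + 1 / a) / (real k + 1)\<^sup>2"

lemma summable_root_bound: "summable (root_bound a)"
proof -
  have "summable (\<lambda>k. 4 * (1 + 1 / a) * (1 / (real k + 1)\<^sup>2))"
    using sums_summable[OF inverse_squares_sums] by (intro summable_mult) (simp add: add.commute)
  thus ?thesis by (simp add: root_bound_def[abs_def])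
qed

lemma summable_root_bound_power:
  assumes "a > 0"
  shows "summable (\<lambda>k. root_bound a k ^ Suc m)"
proof (rule summable_comparison_test')
  show "summable (\<lambda>k. root_bound a 0 ^ m * root_bound a k)"
    by (intro summable_mult summable_root_bound)
  fix k
  have "0 \<le> root_bound a k" using assms by (simp add: root_bound_def)
  moreover have "root_bound a k \<le> root_bound a 0"
    using assms unfolding root_bound_def by (intro divide_left_mono) auto
  ultimately show "norm (root_bound a k ^ Suc m) \<le> root_bound a 0 ^ m * root_bound a k"
    using mult_right_mono[OF power_mono, of "root_bound a k" "root_bound a 0" "root_bound a k" m]
    by (simp add: mult.commute)
qed

text \<open>The facts about reciprocal roots for \<open>h = 1 / n\<close>, which gives the
  undifferentiated term of the equation coefficient 1. Extension by 0 beyond \<open>n\<close> turns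
  the roots into sequences with a common majorant.\<close>

lemma laguerre_reciprocal_roots:
  assumes "a > 0" "n > 0"
  shows "\<exists>u :: nat \<Rightarrow> real. (\<forall>k. u k \<in> {0..root_bound a k}) \<and> (\<forall>k\<ge>n. u k = 0) \<and>
     (\<Sum>k<n. u k) = 1 / a \<and>
     (\<forall>t. poly (laguerre n a (1 / real n)) t = (\<Prod>k<n. 1 - u k * t)) \<and>
     (\<forall>m. (a + real (Suc m)) * (\<Sum>i<n. u i ^ Suc (Suc m)) =
       (\<Sum>k\<le>m. (\<Sum>i<n. u i ^ Suc k) * (\<Sum>i<n. u i ^ Suc (m - k))) + 1 / real n * (\<Sum>i<n. u i ^ Suc m))"
proof -
  define h where "h = 1 / real n"
  have h: "h > 0" using assms by (simp add: h_def)
  obtain u where u: "antimono_on {..<n} u" "\<And>i. i < n \<Longrightarrow> u i > 0"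
      "laguerre n a h = (\<Prod>i<n. [:1, - u i:])"
    using laguerre_factorization[OF assms(1) h] by metis
  have ode: "[:0, 1:] * pderiv (pderiv (\<Prod>i<n. [:1, - u i:])) + [:a, - h:] * pderiv (\<Prod>i<n. [:1, - u i:])
           + (\<Prod>i<n. [:1, - u i:]) = 0"
  proof -
    have "real n * h = 1" using assms(2) by (simp add: h_def)
    thus ?thesis using laguerre_ode[OF assms(1), of n h] unfolding u(3) by simp
  qed
  note ctx = assms(1) less_imp_le[OF h] u(2) ode
  define w where "w k = (if k < n then u k else 0)" for k
  have w_eq: "(\<Sum>k<n. w k ^ m) = (\<Sum>k<n. u k ^ m)" for m
    by (intro sum.cong) (auto simp: w_def)
  have "w k \<in> {0..root_bound a k}" for k
    using u(2)[of k] ode_reciprocal_roots_bound[OF ctx u(1), of k] assms(1)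
    by (auto simp: w_def root_bound_def)
  moreover have "(\<Sum>k<n. w k) = 1 / a"
    using ode_reciprocal_roots_sum[OF ctx] w_eq[of 1] by simp
  moreover have "poly (laguerre n a h) t = (\<Prod>k<n. 1 - w k * t)" for t
    unfolding u(3) poly_prod by (intro prod.cong) (auto simp: w_def mult.commute)
  moreover have "w k = 0" if "k \<ge> n" for k
    using that by (simp add: w_def)
  moreover note ode_power_sum_recursion[OF ctx, folded w_eq]
  ultimately show ?thesis
    unfolding h_def by (intro exI[of _ w]) blast
qed

text \<open>The limits \<open>v k\<close> may vanish, so injectivity and image concern only the
  positive ones; vanishing entries add nothing to the power sums. Injectivity means that each zero
  is counted once.\<close>

lemma bessel_reciprocal_zeros:
  assumes a: "a > 0"
  shows "\<exists>v :: nat \<Rightarrow> real. (\<forall>k. v k \<ge> 0) \<and> (\<forall>m. summable (\<lambda>k. v k ^ Suc m)) \<and>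
    inj_on v {k. v k > 0} \<and> v ` {k. v k > 0} = {w. w > 0 \<and> bessel_series a (1 / w) = 0} \<and>
    (\<forall>m. (a + real (Suc m)) * (\<Sum>k. v k ^ Suc (Suc m)) =
       (\<Sum>j\<le>m. (\<Sum>k. v k ^ Suc j) * (\<Sum>k. v k ^ Suc (m - j))))"
proof -
  define M where "M = root_bound a"
  define P where "P n u \<longleftrightarrow> (\<forall>k. u k \<in> {0..M k}) \<and> (\<forall>k\<ge>n. u k = 0) \<and>
     (\<Sum>k<n. u k) = 1 / a \<and>
     (\<forall>t. poly (laguerre n a (1 / real n)) t = (\<Prod>k<n. 1 - u k * t)) \<and>
     (\<forall>m. (a + real (Suc m)) * (\<Sum>i<n. u i ^ Suc (Suc m)) =
       (\<Sum>k\<le>m. (\<Sum>i<n. u i ^ Suc k) * (\<Sum>i<n. u i ^ Suc (m - k)))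
          + 1 / real n * (\<Sum>i<n. u i ^ Suc m))" for n and u :: "nat \<Rightarrow> real"
  \<comment> \<open>\<open>U n\<close> belongs to index \<open>n + 1\<close>, which keeps the scale
    \<open>1 / (n + 1)\<close> positive.\<close>
  have "\<forall>n. \<exists>u. P (Suc n) u"
    unfolding P_def M_def by (intro allI laguerre_reciprocal_roots[OF a]) simp
  then obtain U where "\<And>n. P (Suc n) (U n)"
    by metis
  hence U: "\<And>n k. U n k \<in> {0..M k}" "\<And>n k. k \<ge> Suc n \<Longrightarrow> U n k = 0"
      "\<And>n. (\<Sum>k<Suc n. U n k) = 1 / a"
      "\<And>n t. poly (laguerre (Suc n) a (1 / real (Suc n))) t = (\<Prod>k<Suc n. 1 - U n k * t)"
      "\<And>n m. (a + real (Suc m)) * (\<Sum>i<Suc n. U n i ^ Suc (Suc m)) =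
       (\<Sum>k\<le>m. (\<Sum>i<Suc n. U n i ^ Suc k) * (\<Sum>i<Suc n. U n i ^ Suc (m - k)))
          + 1 / real (Suc n) * (\<Sum>i<Suc n. U n i ^ Suc m)"
    unfolding P_def by blast+
  obtain r v where r: "strict_mono r" and v: "\<And>k. (\<lambda>j. U (r j) k) \<longlonglongrightarrow> v k"
    using pointwise_convergent_subsequence[of U M, OF U(1)] by metis
  have v0: "v k \<ge> 0" for k
    by (rule LIMSEQ_le_const[OF v]) (use U(1) in auto)
  have r_top: "filterlim (\<lambda>j. Suc (r j)) sequentially sequentially"
    using filterlim_compose[OF filterlim_Suc filterlim_subseq[OF r]] .

  have power_sums: "summable (\<lambda>k. v k ^ Suc m) \<and>
      (\<lambda>j. \<Sum>k<Suc (r j). U (r j) k ^ Suc m) \<longlonglongrightarrow> (\<Sum>k. v k ^ Suc m)" for m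
  proof -
    have *: "eventually (\<lambda>j. summable (\<lambda>k. norm (U (r j) k ^ Suc m))) sequentially \<and>
      summable (\<lambda>k. norm (v k ^ Suc m)) \<and>
      (\<lambda>j. \<Sum>k. U (r j) k ^ Suc m) \<longlonglongrightarrow> (\<Sum>k. v k ^ Suc m)"
    proof (rule tannerys_theorem)
      show "(\<lambda>j. U (r j) k ^ Suc m) \<longlonglongrightarrow> v k ^ Suc m" for k
        by (intro tendsto_intros v)
      show "summable (\<lambda>k. M k ^ Suc m)"
        unfolding M_def by (rule summable_root_bound_power[OF a])
      have "norm (U (r j) k ^ Suc m) \<le> M k ^ Suc m" for j k
        unfolding norm_power using U(1)[of "r j" k] by (intro power_mono) auto
      thus "eventually (\<lambda>(k, j). norm (U (r j) k ^ Suc m) \<le> M k ^ Suc m) (at_top \<times>\<^sub>F sequentially)"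
        by (intro always_eventually) auto
    qed simp
    have "(\<Sum>k. U (r j) k ^ Suc m) = (\<Sum>k<Suc (r j). U (r j) k ^ Suc m)" for j
      by (rule suminf_finite) (use U(2)[of "r j"] in \<open>auto simp: not_less_eq\<close>)
    with * show ?thesis by (auto intro: summable_norm_cancel)
  qed

  have recursion: "(a + real (Suc m)) * (\<Sum>k. v k ^ Suc (Suc m)) =
       (\<Sum>j\<le>m. (\<Sum>k. v k ^ Suc j) * (\<Sum>k. v k ^ Suc (m - j)))" for m
  proof -
    have "(\<lambda>j. (a + real (Suc m)) * (\<Sum>i<Suc (r j). U (r j) i ^ Suc (Suc m))) \<longlonglongrightarrow>
        (a + real (Suc m)) * (\<Sum>k. v k ^ Suc (Suc m))"
      using power_sums by (intro tendsto_intros) blast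
    moreover have "(\<lambda>j. 1 / real (Suc (r j))) \<longlonglongrightarrow> 0"
      using filterlim_compose[OF lim_1_over_n r_top] .
    hence "(\<lambda>j. (\<Sum>k\<le>m. (\<Sum>i<Suc (r j). U (r j) i ^ Suc k) * (\<Sum>i<Suc (r j). U (r j) i ^ Suc (m - k)))
          + 1 / real (Suc (r j)) * (\<Sum>i<Suc (r j). U (r j) i ^ Suc m)) \<longlonglongrightarrow>
        (\<Sum>j\<le>m. (\<Sum>k. v k ^ Suc j) * (\<Sum>k. v k ^ Suc (m - j))) + 0 * (\<Sum>k. v k ^ Suc m)"
      using power_sums by (intro tendsto_add tendsto_sum tendsto_mult) blast+
    ultimately show ?thesis
      unfolding U(5) using LIMSEQ_unique by fastforce
  qed

  have lim: "(\<lambda>j. \<Prod>k<Suc (r j). 1 - U (r j) k * t) \<longlonglongrightarrow> bessel_series a t" for t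
    using filterlim_compose[OF laguerre_tendsto_bessel_series[OF a, of t] r_top] by (simp only: U(4))

  have upper: "\<bar>bessel_series a t\<bar> \<le> (\<Prod>k\<in>I. \<bar>1 - v k * t\<bar>) * exp (1 / a * \<bar>t\<bar>)"
    if "finite I" for I t
  proof (rule tendsto_le[OF sequentially_bot _ tendsto_rabs[OF lim]])
    show "(\<lambda>j. (\<Prod>k\<in>I. \<bar>1 - U (r j) k * t\<bar>) * exp (1 / a * \<bar>t\<bar>)) \<longlonglongrightarrow>
        (\<Prod>k\<in>I. \<bar>1 - v k * t\<bar>) * exp (1 / a * \<bar>t\<bar>)"
      by (intro tendsto_intros v)
    obtain b where b: "I \<subseteq> {..<b}"
      using finite_nat_iff_bounded \<open>finite I\<close> by blast
    have "eventually (\<lambda>j. Suc (r j) \<ge> b) sequentially"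
      using r_top by (simp add: filterlim_at_top)
    thus "eventually (\<lambda>j. \<bar>\<Prod>k<Suc (r j). 1 - U (r j) k * t\<bar> \<le>
        (\<Prod>k\<in>I. \<bar>1 - U (r j) k * t\<bar>) * exp (1 / a * \<bar>t\<bar>)) sequentially"
    proof eventually_elim
      case (elim j)
      show ?case
        by (rule prod_linear_upper_bound) (use U(1,3) b elim in force)+
    qed
  qed

  have lower: "\<exists>K. (\<Prod>k<K. \<bar>1 - v k * t\<bar>) / 2 \<le> \<bar>bessel_series a t\<bar>" if t: "t \<ge> 0" for t
  proof -
    have "summable (\<lambda>k. M k * t)"
      unfolding M_def by (intro summable_mult2 summable_root_bound)
    \<comment> \<open>The tails are those of the majorant, so one \<open>K\<close> serves all
      members of the subsequence.\<close>
    then obtain K where K: "\<And>m n. m \<ge> K \<Longrightarrow> norm (\<Sum>k\<in>{m..<n}. M k * t) < 1 / 2"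
      by (metis summable_Cauchy half_gt_zero_iff zero_less_one)
    have "(\<Prod>k<K. \<bar>1 - v k * t\<bar>) / 2 \<le> \<bar>bessel_series a t\<bar>"
    proof (rule tendsto_le[OF sequentially_bot tendsto_rabs[OF lim]])
      show "(\<lambda>j. (\<Prod>k<K. \<bar>1 - U (r j) k * t\<bar>) / 2) \<longlonglongrightarrow> (\<Prod>k<K. \<bar>1 - v k * t\<bar>) / 2"
        by (intro tendsto_intros v) simp
      have "eventually (\<lambda>j. Suc (r j) \<ge> K) sequentially"
        using r_top by (simp add: filterlim_at_top)
      thus "eventually (\<lambda>j. (\<Prod>k<K. \<bar>1 - U (r j) k * t\<bar>) / 2 \<le>
          \<bar>\<Prod>k<Suc (r j). 1 - U (r j) k * t\<bar>) sequentially"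
      proof eventually_elim
        case (elim j)
        have "(\<Sum>k\<in>{K..<Suc (r j)}. U (r j) k * t) \<le> (\<Sum>k\<in>{K..<Suc (r j)}. M k * t)"
          using U(1) t by (intro sum_mono mult_right_mono) auto
        also have "\<dots> \<le> 1 / 2" using K[of K "Suc (r j)"] by simp
        finally show ?case
          using U(1) t elim by (intro prod_linear_lower_bound) auto
      qed
    qed
    thus ?thesis ..
  qed

  have zero: "bessel_series a (1 / v k) = 0" if "v k > 0" for k
    using upper[of "{k}" "1 / v k"] that by simp
  have zeros: "v ` {k. v k > 0} = {w. w > 0 \<and> bessel_series a (1 / w) = 0}"
  proof (intro equalityI subsetI)
    fix w assume "w \<in> {w. w > 0 \<and> bessel_series a (1 / w) = 0}"
    hence w: "w > 0" "bessel_series a (1 / w) = 0" by auto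
    obtain K where "(\<Prod>k<K. \<bar>1 - v k * (1 / w)\<bar>) / 2 \<le> 0"
      using lower[of "1 / w"] w by auto
    moreover have "(\<Prod>k<K. \<bar>1 - v k * (1 / w)\<bar>) \<ge> 0"
      by (intro prod_nonneg) auto
    ultimately have "(\<Prod>k<K. \<bar>1 - v k * (1 / w)\<bar>) = 0" by simp
    then obtain k where "\<bar>1 - v k * (1 / w)\<bar> = 0" by (auto simp: prod_zero_iff)
    hence "v k = w" using w by (simp add: field_simps)
    thus "w \<in> v ` {k. v k > 0}" using w by auto
  qed (use zero in auto)

  have inj: "inj_on v {k. v k > 0}"
  proof (rule inj_onI, rule ccontr)
    fix i j assume "i \<in> {k. v k > 0}" "j \<in> {k. v k > 0}" and eq: "v i = v j" and ne: "i \<noteq> j"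
    define w where "w = v i"
    have w: "w > 0" "v i = w" "v j = w" using \<open>i \<in> _\<close> eq by (auto simp: w_def)
    define y where "y = 1 / w"
    have y: "y > 0" "bessel_series a y = 0" using zero[of i] w by (auto simp: y_def)
    \<comment> \<open>Two indices with the same value leave two factors vanishing at
      \<open>y\<close>. Then the series is \<open>O((t - y)\<^sup>2)\<close> and its derivative at
      \<open>y\<close> is 0, against simplicity of the zeros.\<close>
    have bound: "\<bar>bessel_series a t\<bar> \<le> (w * \<bar>t - y\<bar>)\<^sup>2 * exp (1 / a * \<bar>t\<bar>)" for t
    proof -
      have "1 - w * t = - (w * (t - y))" using w by (simp add: y_def field_simps)
      hence "\<bar>1 - w * t\<bar> = w * \<bar>t - y\<bar>" using w(1) by (simp add: abs_mult)
      thus ?thesis using upper[of "{i, j}" t] w ne by (simp add: power2_eq_square)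
    qed
    have "((\<lambda>t. (bessel_series a t - bessel_series a y) / (t - y)) \<longlongrightarrow> bessel_series' a y) (at y)"
      using has_real_derivative_bessel_series[OF a, of y] by (simp add: has_field_derivative_iff)
    moreover have "((\<lambda>t. (bessel_series a t - bessel_series a y) / (t - y)) \<longlongrightarrow> 0) (at y)"
    proof (rule Lim_null_comparison)
      have "((\<lambda>t. w\<^sup>2 * \<bar>t - y\<bar> * exp (1 / a * \<bar>t\<bar>)) \<longlongrightarrow> w\<^sup>2 * \<bar>y - y\<bar> * exp (1 / a * \<bar>y\<bar>)) (at y)"
        by (intro tendsto_intros)
      thus "((\<lambda>t. w\<^sup>2 * \<bar>t - y\<bar> * exp (1 / a * \<bar>t\<bar>)) \<longlongrightarrow> 0) (at y)" by simp
      have "norm ((bessel_series a t - bessel_series a y) / (t - y)) \<le> w\<^sup>2 * \<bar>t - y\<bar> * exp (1 / a * \<bar>t\<bar>)"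
        if "t \<noteq> y" for t
      proof -
        have "\<bar>bessel_series a t\<bar> / \<bar>t - y\<bar> \<le> (w * \<bar>t - y\<bar>)\<^sup>2 * exp (1 / a * \<bar>t\<bar>) / \<bar>t - y\<bar>"
          by (intro divide_right_mono bound) simp
        also have "\<dots> = w\<^sup>2 * \<bar>t - y\<bar> * exp (1 / a * \<bar>t\<bar>)"
          using that by (simp add: power2_eq_square)
        finally show ?thesis by (simp add: y)
      qed
      thus "eventually (\<lambda>t. norm ((bessel_series a t - bessel_series a y) / (t - y)) \<le>
          w\<^sup>2 * \<bar>t - y\<bar> * exp (1 / a * \<bar>t\<bar>)) (at y)"
        by (auto simp: eventually_at_filter)
    qed
    ultimately have "bessel_series' a y = 0"
      using LIM_unique by blast
    with bessel_series_no_double_zero[OF a y] show False by simp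
  qed
  from power_sums recursion v0 inj zeros show ?thesis by blast
qed

section \<open>Power sums and double sums over the Bessel zeros\<close>

text \<open>The square \<open>A \<times> A\<close> splits into the diagonal and two triangles;
  swapping coordinates carries one triangle to the other and exchanges the exponents.\<close>

lemma infsum_power_product_split:
  fixes X :: "nat \<Rightarrow> real" and A :: "nat set"
  assumes nn: "\<And>k. k \<in> A \<Longrightarrow> X k \<ge> 0"
    and sm: "\<And>m. (\<lambda>k. X k ^ Suc m) summable_on A"
  defines "D \<equiv> (\<lambda>p q. \<Sum>\<^sub>\<infinity>(m, n)\<in>{(m, n). m \<in> A \<and> n \<in> A \<and> m > n}. X m ^ p * X n ^ q)"
  shows "infsum (\<lambda>k. X k ^ Suc i) A * infsum (\<lambda>k. X k ^ Suc j) A =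
    infsum (\<lambda>k. X k ^ (Suc i + Suc j)) A + D (Suc i) (Suc j) + D (Suc j) (Suc i)"
proof -
  let ?f = "\<lambda>(m, n). X m ^ Suc i * X n ^ Suc j"
  let ?S = "\<lambda>m. infsum (\<lambda>k. X k ^ Suc m) A"
  define U where "U = {(m, n). m \<in> A \<and> n \<in> A \<and> m > n}"
  define L where "L = {(m, n). m \<in> A \<and> n \<in> A \<and> m < n}"
  define E where "E = (\<lambda>k. (k, k)) ` A"
  have summable: "?f summable_on A \<times> A"
  proof (rule summable_on_SigmaI)
    show "((\<lambda>n. ?f (m, n)) has_sum (X m ^ Suc i * ?S j)) A" for m
      using has_sum_cmult_right[OF has_sum_infsum[OF sm[of j]], of "X m ^ Suc i"] by simp
    show "(\<lambda>m. X m ^ Suc i * ?S j) summable_on A"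
      by (intro summable_on_cmult_left sm)
  qed (use nn in auto)
  have "?S i * ?S j = (\<Sum>\<^sub>\<infinity>m\<in>A. X m ^ Suc i * ?S j)"
    by (rule infsum_cmult_left'[symmetric])
  also have "\<dots> = (\<Sum>\<^sub>\<infinity>m\<in>A. \<Sum>\<^sub>\<infinity>n\<in>A. X m ^ Suc i * X n ^ Suc j)"
    by (simp only: infsum_cmult_right')
  also have "\<dots> = infsum ?f (A \<times> A)"
    using infsum_Sigma'_banach[of "\<lambda>m n. X m ^ Suc i * X n ^ Suc j" A "\<lambda>_. A"] summable by simp
  also have "A \<times> A = E \<union> U \<union> L"
    by (auto simp: E_def U_def L_def)
  also have "infsum ?f (E \<union> U \<union> L) = infsum ?f E + infsum ?f U + infsum ?f L"
  proof -
    have sub: "?f summable_on B" if "B \<subseteq> A \<times> A" for B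
      using summable_on_subset_banach[OF summable that] .
    have "E \<inter> U = {}" "(E \<union> U) \<inter> L = {}"
      by (auto simp: E_def U_def L_def)
    moreover have "?f summable_on E" "?f summable_on U" "?f summable_on L" "?f summable_on E \<union> U"
      by (intro sub; force simp: E_def U_def L_def)+
    ultimately show ?thesis by (simp only: infsum_Un_disjoint)
  qed
  also have "infsum ?f E = infsum (\<lambda>k. X k ^ (Suc i + Suc j)) A"
    unfolding E_def by (subst infsum_reindex) (auto simp: inj_on_def o_def power_add mult_ac)
  also have "infsum ?f L = infsum (\<lambda>(m, n). X m ^ Suc j * X n ^ Suc i) U"
    by (rule infsum_reindex_bij_witness[of _ prod.swap prod.swap]) (auto simp: U_def L_def)
  finally show ?thesis
    by (simp add: D_def U_def)
qed

text \<open>Each of the \<open>m + 1\<close> products has the same diagonal part. The two triangular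
  parts differ for a single \<open>j\<close>, but the reversal of \<open>j\<close> to
  \<open>m - j\<close> makes their totals equal.\<close>

lemma infsum_power_convolution_split:
  fixes X :: "nat \<Rightarrow> real" and A :: "nat set"
  assumes "\<And>k. k \<in> A \<Longrightarrow> X k \<ge> 0"
    and "\<And>m. (\<lambda>k. X k ^ Suc m) summable_on A"
  defines "D \<equiv> (\<lambda>p q. \<Sum>\<^sub>\<infinity>(m, n)\<in>{(m, n). m \<in> A \<and> n \<in> A \<and> m > n}. X m ^ p * X n ^ q)"
  shows "(\<Sum>j\<le>m. infsum (\<lambda>k. X k ^ Suc j) A * infsum (\<lambda>k. X k ^ Suc (m - j)) A) =
    real (Suc m) * infsum (\<lambda>k. X k ^ Suc (Suc m)) A + 2 * (\<Sum>j\<le>m. D (Suc j) (Suc (m - j)))"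
proof -
  have "(\<Sum>j\<le>m. infsum (\<lambda>k. X k ^ Suc j) A * infsum (\<lambda>k. X k ^ Suc (m - j)) A) =
      (\<Sum>j\<le>m. infsum (\<lambda>k. X k ^ Suc (Suc m)) A + D (Suc j) (Suc (m - j)) + D (Suc (m - j)) (Suc j))"
  proof (rule sum.cong[OF refl])
    fix j assume "j \<in> {..m}"
    hence "Suc j + Suc (m - j) = Suc (Suc m)" by simp
    with infsum_power_product_split[of A X j "m - j", OF assms(1,2)]
    show "infsum (\<lambda>k. X k ^ Suc j) A * infsum (\<lambda>k. X k ^ Suc (m - j)) A =
      infsum (\<lambda>k. X k ^ Suc (Suc m)) A + D (Suc j) (Suc (m - j)) + D (Suc (m - j)) (Suc j)"
      unfolding D_def by (simp only:)
  qed
  also have "\<dots> = real (Suc m) * infsum (\<lambda>k. X k ^ Suc (Suc m)) A +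
      (\<Sum>j\<le>m. D (Suc j) (Suc (m - j))) + (\<Sum>j\<le>m. D (Suc (m - j)) (Suc j))"
    by (simp add: sum.distrib)
  also have "(\<Sum>j\<le>m. D (Suc (m - j)) (Suc j)) = (\<Sum>j\<le>m. D (Suc j) (Suc (m - j)))"
    by (rule sum.reindex_bij_witness[of _ "\<lambda>j. m - j" "\<lambda>j. m - j"]) auto
  finally show ?thesis by simp
qed

section \<open>From zeros of the series to zeros of \<open>bessel_J\<close>\<close>

lemma bessel_J_eq_0_iff:
  assumes "\<nu> > -1" "z > 0"
  shows "bessel_J \<nu> z = 0 \<longleftrightarrow> bessel_series (\<nu> + 1) (z\<^sup>2 / 4) = 0"
proof -
  have G: "Gamma (\<nu> + 1) > 0" using assms by (intro Gamma_real_pos) simp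
  have nz: "\<nu> + 1 \<notin> \<int>\<^sub>\<le>\<^sub>0" using assms by (auto elim!: nonpos_Ints_cases)
  have "(-1) ^ k / (Gamma (\<nu> + real k + 1) * fact k) * (z\<^sup>2 / 4) ^ k =
      1 / Gamma (\<nu> + 1) * (bessel_coeff (\<nu> + 1) k * (z\<^sup>2 / 4) ^ k)" for k
  proof -
    have "Gamma (\<nu> + real k + 1) = Gamma (\<nu> + 1) * pochhammer (\<nu> + 1) k"
      using pochhammer_Gamma[OF nz, of k] G by (simp add: field_simps)
    thus ?thesis by (simp add: bessel_coeff_def mult_ac)
  qed
  hence "bessel_J \<nu> z = (z / 2) powr \<nu> * (1 / Gamma (\<nu> + 1) * bessel_series (\<nu> + 1) (z\<^sup>2 / 4))"
    unfolding bessel_J_def bessel_series_def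
    using suminf_mult[OF summable_bessel_series[of "\<nu> + 1" "z\<^sup>2 / 4"], of "1 / Gamma (\<nu> + 1)"] assms
    by simp
  thus ?thesis using less_imp_neq[OF G] assms by simp
qed

text \<open>Both \<open>4 / (x k)\<^sup>2\<close> and the positive \<open>v k\<close> enumerate the
  set \<open>W\<close> without repetition, so their power sums agree. The recursion is homogeneous,
  hence the factor 4 cancels.\<close>

lemma positive_bessel_zeros_power_sums:
  assumes "\<nu> > -1" and zeros: "positive_bessel_zeros \<nu> x"
  defines "S \<equiv> (\<lambda>m. \<Sum>\<^sub>\<infinity>k\<in>{1..}. (1 / (x k)\<^sup>2) ^ m)"
  shows "(\<lambda>k. (1 / (x k)\<^sup>2) ^ Suc m) summable_on {1..}"
    and "(\<nu> + 1 + real (Suc m)) * S (Suc (Suc m)) = (\<Sum>j\<le>m. S (Suc j) * S (Suc (m - j)))"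
proof -
  define a where "a = \<nu> + 1"
  have a: "a > 0" using assms(1) by (simp add: a_def)
  obtain v :: "nat \<Rightarrow> real" where v: "\<And>k. v k \<ge> 0" "\<And>m. summable (\<lambda>k. v k ^ Suc m)"
      "inj_on v {k. v k > 0}" "v ` {k. v k > 0} = {w. w > 0 \<and> bessel_series a (1 / w) = 0}"
      "\<And>m. (a + real (Suc m)) * (\<Sum>k. v k ^ Suc (Suc m)) =
         (\<Sum>j\<le>m. (\<Sum>k. v k ^ Suc j) * (\<Sum>k. v k ^ Suc (m - j)))"
  proof -
    from bessel_reciprocal_zeros[OF a] show thesis
      by (elim exE conjE, intro that) (assumption | erule spec)+
  qed
  define W where "W = {w. w > 0 \<and> bessel_series a (1 / w) = 0}"
  have x_mono: "strict_mono_on {1..} x"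
    and x_image: "x ` {1..} = {z. 0 < z \<and> bessel_J \<nu> z = 0}"
    using zeros by (auto simp: positive_bessel_zeros_def)
  have x_inj: "inj_on x {1..}"
    using x_mono by (rule strict_mono_on_imp_inj_on)
  have "bij_betw (\<lambda>z. 4 / z\<^sup>2) {z. 0 < z \<and> bessel_J \<nu> z = 0} W"
  proof (rule bij_betw_byWitness[where f' = "\<lambda>w. 2 / sqrt w"])
    show "(\<lambda>z. 4 / z\<^sup>2) ` {z. 0 < z \<and> bessel_J \<nu> z = 0} \<subseteq> W"
      using bessel_J_eq_0_iff[OF assms(1)] by (auto simp: W_def a_def)
    show "(\<lambda>w. 2 / sqrt w) ` W \<subseteq> {z. 0 < z \<and> bessel_J \<nu> z = 0}"
      using bessel_J_eq_0_iff[OF assms(1)] by (auto simp: W_def a_def power_divide)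
  qed (auto simp: W_def power_divide real_sqrt_divide)
  hence bij_x: "bij_betw (\<lambda>k. 4 / (x k)\<^sup>2) {1..} W"
    using bij_betw_trans[of x "{1..}" "{z. 0 < z \<and> bessel_J \<nu> z = 0}" "\<lambda>z. 4 / z\<^sup>2" W] x_inj x_image
    by (simp add: bij_betw_def o_def)
  have bij_v: "bij_betw v {k. v k > 0} W"
    using v(3,4) by (simp add: bij_betw_def W_def)
  have has_sum: "((\<lambda>k. (1 / (x k)\<^sup>2) ^ Suc m) has_sum ((\<Sum>k. v k ^ Suc m) / 4 ^ Suc m)) {1..}" for m
  proof -
    have "((\<lambda>k. v k ^ Suc m) has_sum (\<Sum>k. v k ^ Suc m)) UNIV"
      using v(1) v(2)[of m] by (intro norm_summable_imp_has_sum summable_sums) (simp_all add: abs_mult)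
    hence "((\<lambda>k. v k ^ Suc m) has_sum (\<Sum>k. v k ^ Suc m)) {k. v k > 0}"
      by (subst has_sum_cong_neutral[of UNIV _ _ "\<lambda>k. v k ^ Suc m"])
         (use v(1) in \<open>auto simp: not_less intro: antisym\<close>)
    hence "((\<lambda>w. w ^ Suc m) has_sum (\<Sum>k. v k ^ Suc m)) W"
      by (subst has_sum_reindex_bij_betw[OF bij_v, symmetric])
    hence "((\<lambda>k. (4 / (x k)\<^sup>2) ^ Suc m) has_sum (\<Sum>k. v k ^ Suc m)) {1..}"
      by (subst has_sum_reindex_bij_betw[OF bij_x])
    from has_sum_cmult_left[OF this, of "1 / 4 ^ Suc m"] show ?thesis
      by (simp add: power_divide)
  qed
  show "(\<lambda>k. (1 / (x k)\<^sup>2) ^ Suc m) summable_on {1..}"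
    using has_sum by (rule has_sum_imp_summable)
  have S: "S (Suc m) = (\<Sum>k. v k ^ Suc m) / 4 ^ Suc m" for m
    unfolding S_def by (rule infsumI) (rule has_sum)
  have "(\<Sum>j\<le>m. S (Suc j) * S (Suc (m - j))) =
      (\<Sum>j\<le>m. (\<Sum>k. v k ^ Suc j) * (\<Sum>k. v k ^ Suc (m - j)) / 4 ^ Suc (Suc m))"
  proof (rule sum.cong[OF refl])
    fix j assume "j \<in> {..m}"
    hence "(4::real) ^ Suc (Suc m) = 4 ^ Suc j * 4 ^ Suc (m - j)"
      by (subst power_add[symmetric]) simp
    thus "S (Suc j) * S (Suc (m - j)) =
        (\<Sum>k. v k ^ Suc j) * (\<Sum>k. v k ^ Suc (m - j)) / 4 ^ Suc (Suc m)"
      unfolding S by simp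
  qed
  also have "\<dots> = (a + real (Suc m)) * S (Suc (Suc m))"
    unfolding sum_divide_distrib[symmetric] v(5)[symmetric] S by simp
  finally show "(\<nu> + 1 + real (Suc m)) * S (Suc (Suc m)) = (\<Sum>j\<le>m. S (Suc j) * S (Suc (m - j)))"
    by (simp add: a_def)
qed

theorem theorem5p2:
  fixes \<nu> :: real and x :: "nat \<Rightarrow> real" and s :: int
  assumes "\<nu> > -1"
    and "positive_bessel_zeros \<nu> x"
    and "s \<ge> 0"
  shows "bessel_zeta x (2 * s + 6) =
    2 / (\<nu> + 1) *
      (\<Sum>(a, b)\<in>{(a, b). a + b = s \<and> a \<ge> -1 \<and> b \<ge> 0}.
         bessel_double_zeta x (4 + 2 * a) (2 + 2 * b))"
proof -
  \<comment> \<open>With \<open>j = a + 1\<close> running from 0 to \<open>m = s + 1\<close>, the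
    exponents become \<open>4 + 2 * a = 2 * (j + 1)\<close> and
    \<open>2 + 2 * b = 2 * (m - j + 1)\<close>.\<close>
  define m where "m = nat s + 1"
  define X where "X k = 1 / (x k)\<^sup>2" for k
  define D where "D p q = (\<Sum>\<^sub>\<infinity>(m, n)\<in>{(m, n). m \<in> {1..} \<and> n \<in> {1..} \<and> m > n}. X m ^ p * X n ^ q)" for p q
  have powi: "x k powi (- (2 * int p)) = X k ^ p" for k p
  proof -
    have "x k powi (- int (2 * p)) = inverse (x k ^ (2 * p))"
      by (simp only: power_int_minus power_int_of_nat)
    thus ?thesis by (simp add: X_def power_divide power_mult inverse_eq_divide)
  qed
  have zeta: "bessel_zeta x (2 * s + 6) = infsum (\<lambda>k. X k ^ Suc (Suc m)) {1..}"
  proof -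
    have "2 * s + 6 = 2 * int (Suc (Suc m))" using assms(3) by (simp add: m_def)
    thus ?thesis by (simp only: bessel_zeta_def powi)
  qed
  have double_zeta: "bessel_double_zeta x (2 * int p) (2 * int q) = D p q" for p q
    unfolding bessel_double_zeta_def D_def powi by (rule infsum_cong_neutral) auto
  have sum: "(\<Sum>(a, b)\<in>{(a, b). a + b = s \<and> a \<ge> -1 \<and> b \<ge> 0}.
      bessel_double_zeta x (4 + 2 * a) (2 + 2 * b)) = (\<Sum>j\<le>m. D (Suc j) (Suc (m - j)))"
  proof (rule sum.reindex_bij_witness[of _ "\<lambda>j. (int j - 1, s + 1 - int j)" "\<lambda>(a, b). nat (a + 1)"])
    fix c assume "c \<in> {(a, b). a + b = s \<and> a \<ge> -1 \<and> b \<ge> 0}"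
    then obtain a b where c: "c = (a, b)" "a + b = s" "a \<ge> -1" "b \<ge> 0" by auto
    define j where "j = nat (a + 1)"
    have "4 + 2 * a = 2 * int (Suc j)" "2 + 2 * b = 2 * int (Suc (m - j))"
      using c assms(3) by (simp_all add: j_def m_def)
    thus "D (Suc (case c of (a, b) \<Rightarrow> nat (a + 1))) (Suc (m - (case c of (a, b) \<Rightarrow> nat (a + 1)))) =
        (case c of (a, b) \<Rightarrow> bessel_double_zeta x (4 + 2 * a) (2 + 2 * b))"
      unfolding c(1) prod.case j_def[symmetric] by (simp only: double_zeta)
  qed (use assms(3) in \<open>auto simp: m_def\<close>)
  have nn: "X k \<ge> 0" for k by (simp add: X_def)
  note power_sums = positive_bessel_zeros_power_sums[OF assms(1,2), folded X_def]
  have "(\<nu> + 1 + real (Suc m)) * infsum (\<lambda>k. X k ^ Suc (Suc m)) {1..} =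
      real (Suc m) * infsum (\<lambda>k. X k ^ Suc (Suc m)) {1..} + 2 * (\<Sum>j\<le>m. D (Suc j) (Suc (m - j)))"
    unfolding power_sums(2) D_def by (rule infsum_power_convolution_split[OF nn power_sums(1)])
  \<comment> \<open>The diagonal contributes \<open>m + 1\<close> copies of the zeta value, which
    cancel against the factor in the recursion and leave exactly \<open>\<nu> + 1\<close>.\<close>
  hence "(\<nu> + 1) * bessel_zeta x (2 * s + 6) = 2 * (\<Sum>j\<le>m. D (Suc j) (Suc (m - j)))"
    unfolding zeta by (simp add: algebra_simps)
  thus ?thesis
    unfolding sum using assms(1) by (simp add: field_simps)
qed

end
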